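(* For any index $(k_{1}, \ldots , k_{r}) \in {\mathbb N}^{r}$ with $r \ge 2$, we have \begin{align*} &\phi((-1)^{k_{r}}x_0^{k_{r}}(y_{k_{1}} \mathbin{\sqcup\!\sqcup} \cdots \mathbin{\sqcup\!\sqcup} y_{k_{r-1}}))\\ &=\sum_{a=1}^{r}(-1)^{k_{a}}x_0^{k_{a}}(y_{k_{1}} \mathbin{\sqcup\!\sqcup} \cdots \mathbin{\sqcup\!\sqcup} y_{k_{a-1}}\mathbin{\sqcup\!\sqcup} y_{k_{a+1}} \mathbin{\sqcup\!\sqcup} \cdots \mathbin{\sqcup\!\sqcup} y_{k_{r}}). \end{align*}
   Context: Let $\mathfrak{h}=\mathbb{Q}\langle x_0,x_1\rangle$, $\mathfrak{h}^1=\mathbb{Q}+\mathfrak{h}x_1$, $y_k=x_0^{k-1}x_1$. The shuffle product $\mathbin{\sqcup\!\sqcup}$ on $\mathfrak{h}$ is defined by $uw\mathbin{\sqcup\!\sqcup} vw'=u(w\mathbin{\sqcup\!\sqcup} vw')+v(uw\mathbin{\sqcup\!\sqcup} w')$ for $u,v\in\{x_0,x_1\}$, $w,w'\in\mathfrak{h}$, with $1\mathbin{\sqcup\!\sqcup} w=w\mathbin{\sqcup\!\sqcup} 1=w$. Let $\phi:\mathfrak{h}^1\to\mathfrak{h}^1$ be the $\mathbb{Q}$-linear map with $\phi(1)=1$ and $\phi(y_{k_1}\cdots y_{k_r})=\sum_{a=0}^r(-1)^{k_1+\cdots+k_a}(y_{k_a}y_{k_{a-1}}\cdots y_{k_1})\mathbin{\sqcup\!\sqcup}(y_{k_{a+1}}y_{k_{a+2}}\cdots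 y_{k_r})$. *)

theory Defs
  imports Complex_Main "HOL-Library.Poly_Mapping"
begin

datatype letter = X0 | X1

text \<open>
  Words form the free monoid under concatenation. With the additive class instance below, the
  convolution product of \<^typ>\<open>letter list \<Rightarrow>\<^sub>0 rat\<close> is the concatenation product, so this type is
  the free algebra on two generators. It is non-commutative.
\<close>

instantiation list :: (type) monoid_add
begin

definition zero_list :: "'a list" where "zero_list = []"

definition plus_list :: "'a list \<Rightarrow> 'a list \<Rightarrow> 'a list" where "plus_list u v = u @ v"

instance by standard (simp_all add: zero_list_def plus_list_def)

end

type_synonym word = "letter list"

type_synonym h = "word \<Rightarrow>\<^sub>0 rat"

abbreviation scalar :: "rat \<Rightarrow> h" where "scalar c \<equiv> Poly_Mapping.single [] c"

abbreviation monom :: "word \<Rightarrow> h" where "monom w \<equiv> Poly_Mapping.single w 1"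

definition x\<^sub>0 :: h where "x\<^sub>0 = monom [X0]"

definition x\<^sub>1 :: h where "x\<^sub>1 = monom [X1]"

definition h\<^sub>1 :: "h set" where "h\<^sub>1 = {scalar c + p * x\<^sub>1 | c p. True}"

text \<open>To be used for \<open>k \<ge> 1\<close> only.\<close>

definition y :: "nat \<Rightarrow> h" where "y k = x\<^sub>0 ^ (k - 1) * x\<^sub>1"

definition linear_ext :: "(word \<Rightarrow> h) \<Rightarrow> h \<Rightarrow> h" where
  "linear_ext f p = (\<Sum>w\<in>Poly_Mapping.keys p. scalar (Poly_Mapping.lookup p w) * f w)"

fun shuffle_word :: "word \<Rightarrow> word \<Rightarrow> h" where
  "shuffle_word [] w = monom w"
| "shuffle_word w [] = monom w"
| "shuffle_word (u # w) (v # w') =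
     monom [u] * shuffle_word w (v # w') + monom [v] * shuffle_word (u # w) w'"

definition shuffle :: "h \<Rightarrow> h \<Rightarrow> h" (infixl \<open>\<squnion>\<squnion>\<close> 70) where
  "p \<squnion>\<squnion> q = linear_ext (\<lambda>u. linear_ext (\<lambda>v. shuffle_word u v) q) p"

definition shuffle_list :: "h list \<Rightarrow> h" where
  "shuffle_list ps = foldr (\<squnion>\<squnion>) ps 1"

text \<open>The word underlying the monomial \<open>y k\<^sub>1 * \<dots> * y k\<^sub>r\<close>.\<close>

definition y_word :: "nat list \<Rightarrow> word" where
  "y_word ks = concat (map (\<lambda>k. replicate (k - 1) X0 @ [X1]) ks)"

definition indices :: "nat list set" where "indices = {ks. \<forall>k\<in>set ks. 1 \<le> k}"

definition phi_index :: "nat list \<Rightarrow> h" where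
  "phi_index ks = (\<Sum>a=0..length ks. (-1) ^ sum_list (take a ks) *
     (prod_list (map y (rev (take a ks))) \<squnion>\<squnion> prod_list (map y (drop a ks))))"

text \<open>
  The words \<open>y_word ks\<close> with \<open>ks \<in> indices\<close> form a basis of \<open>h\<^sub>1\<close> (see \<open>inj_on_y_word\<close> and
  \<open>h\<^sub>1_eq\<close> below). Outside \<open>h\<^sub>1\<close> the map \<open>\<phi>\<close> is made total by sending the remaining words to 0.
\<close>

definition \<phi> :: "h \<Rightarrow> h" where
  "\<phi> = linear_ext (\<lambda>w. if w \<in> y_word ` indices then phi_index (inv_into indices y_word w) else 0)"


lemma linear_ext_superset:
  assumes "finite A" "Poly_Mapping.keys p \<subseteq> A"
  shows "linear_ext f p = (\<Sum>w\<in>A. scalar (Poly_Mapping.lookup p w) * f w)"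
  unfolding linear_ext_def
  by (rule sum.mono_neutral_left) (use assms in \<open>auto simp: in_keys_iff\<close>)

lemma linear_ext_add: "linear_ext f (p + q) = linear_ext f p + linear_ext f q"
proof -
  let ?A = "Poly_Mapping.keys p \<union> Poly_Mapping.keys q"
  have "linear_ext f s = (\<Sum>w\<in>?A. scalar (Poly_Mapping.lookup s w) * f w)"
    if "s \<in> {p, q, p + q}" for s
    by (rule linear_ext_superset) (use that Poly_Mapping.keys_add[of p q] in auto)
  then show ?thesis
    by (simp add: lookup_add single_add distrib_right sum.distrib)
qed

lemma scalar_mult: "scalar c * scalar d = scalar (c * d)"
  using mult_single[of "[]" c "[]" d] by (simp add: plus_list_def)

lemma scalar_one: "scalar 1 = 1"
  by (metis single_one zero_list_def)

lemma lookup_scalar_mult: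
  "Poly_Mapping.lookup (scalar c * p) w = c * Poly_Mapping.lookup p w"
proof -
  have "scalar c * p = Poly_Mapping.map ((*) c) p"
    unfolding mult_map_scale_conv_mult zero_list_def ..
  then show ?thesis by (simp add: Poly_Mapping.map.rep_eq when_def)
qed

lemma linear_ext_scale: "linear_ext f (scalar c * p) = scalar c * linear_ext f p"
proof -
  have "Poly_Mapping.keys (scalar c * p) \<subseteq> Poly_Mapping.keys p"
    by (auto simp: in_keys_iff lookup_scalar_mult)
  then have "linear_ext f (scalar c * p) =
      (\<Sum>w\<in>Poly_Mapping.keys p. scalar (Poly_Mapping.lookup (scalar c * p) w) * f w)"
    by (intro linear_ext_superset) auto
  then show ?thesis
    by (simp add: lookup_scalar_mult linear_ext_def sum_distrib_left mult.assoc
        flip: scalar_mult)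
qed

lemma linear_ext_monom [simp]: "linear_ext f (monom w) = f w"
  by (simp add: linear_ext_def scalar_one)

lemma phi_add: "\<phi> (p + q) = \<phi> p + \<phi> q"
  by (simp add: \<phi>_def linear_ext_add)

lemma phi_scale: "\<phi> (scalar c * p) = scalar c * \<phi> p"
  by (simp add: \<phi>_def linear_ext_scale)

lemma y_word_Cons: "y_word (k # ks) = replicate (k - 1) X0 @ X1 # y_word ks"
  by (simp add: y_word_def)

lemma inj_on_y_word: "inj_on y_word indices"
proof -
  have aux: "m = n \<and> u = v"
    if "replicate m X0 @ X1 # u = replicate n X0 @ X1 # v" for m n u v
    using that
  proof (induction m arbitrary: n)
    case 0
    then show ?case by (cases n) auto
  next
    case (Suc m)
    then show ?case by (cases n) auto
  qed
  have "ks = ls" if "ks \<in> indices" "ls \<in> indices" "y_word ks = y_word ls" for ks ls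
    using that
  proof (induction ks arbitrary: ls)
    case Nil
    then show ?case by (cases ls) (auto simp: y_word_def)
  next
    case (Cons k ks)
    obtain l ls' where ls: "ls = l # ls'"
      using Cons.prems(3) by (cases ls) (auto simp: y_word_def)
    have "replicate (k - 1) X0 @ X1 # y_word ks = replicate (l - 1) X0 @ X1 # y_word ls'"
      using Cons.prems(3) unfolding ls y_word_Cons .
    from aux[OF this] have "k - 1 = l - 1" "y_word ks = y_word ls'" by auto
    moreover have "ks \<in> indices" "ls' \<in> indices" "1 \<le> k" "1 \<le> l"
      using Cons.prems(1,2) unfolding ls by (auto simp: indices_def)
    ultimately show ?case
      using Cons.IH[of ls'] unfolding ls by simp
  qed
  then show ?thesis by (auto intro: inj_onI)
qed

lemma monom_append: "monom (u @ v) = monom u * monom v"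
  using mult_single[of u "1::rat" v "1"] by (simp add: plus_list_def)

lemma x0_power: "x\<^sub>0 ^ n = monom (replicate n X0)"
  by (induction n) (simp_all add: scalar_one x\<^sub>0_def flip: monom_append)

lemma prod_list_y: "prod_list (map y ks) = monom (y_word ks)"
  by (induction ks)
     (simp_all add: y_word_def y_def x0_power x\<^sub>1_def scalar_one mult.assoc flip: monom_append)

lemma phi_y:
  assumes "\<forall>k\<in>set ks. 1 \<le> k"
  shows "\<phi> (prod_list (map y ks)) =
    (\<Sum>a=0..length ks. (-1) ^ sum_list (take a ks) *
       (prod_list (map y (rev (take a ks))) \<squnion>\<squnion> prod_list (map y (drop a ks))))"
proof -
  from assms have "ks \<in> indices" by (simp add: indices_def)
  then show ?thesis
    using inj_on_y_word
    by (simp add: \<phi>_def prod_list_y[of ks] flip: phi_index_def)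
qed

lemma mem_y_words_iff: "w \<in> y_word ` indices \<longleftrightarrow> w = [] \<or> last w = X1"
proof
  assume "w \<in> y_word ` indices"
  then obtain ks where "w = y_word ks" by auto
  then show "w = [] \<or> last w = X1"
    by (cases ks rule: rev_cases) (auto simp: y_word_def)
next
  have *: "\<exists>ks\<in>indices. replicate n X0 @ w = y_word ks" if "w \<noteq> []" "last w = X1" for w n
    using that
  proof (induction w arbitrary: n)
    case (Cons x w)
    show ?case
    proof (cases x)
      case X0
      with Cons have "w \<noteq> []" "last w = X1" by (auto split: if_splits)
      from Cons.IH[OF this, of "Suc n"] X0 show ?thesis
        by (simp add: replicate_append_same[symmetric])
    next
      case X1
      have "\<exists>ks\<in>indices. w = y_word ks"
      proof (cases "w = []")
        case True
        then show ?thesis by (intro bexI[of _ "[]"]) (auto simp: y_word_def indices_def)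
      next
        case False
        with Cons.IH[of 0] Cons.prems show ?thesis by simp
      qed
      then obtain ks where "ks \<in> indices" "w = y_word ks" by auto
      with X1 show ?thesis
        by (intro bexI[of _ "Suc n # ks"]) (auto simp: y_word_Cons indices_def)
    qed
  qed simp
  assume "w = [] \<or> last w = X1"
  then show "w \<in> y_word ` indices"
  proof (cases "w = []")
    case True
    then show ?thesis by (intro image_eqI[of _ _ "[]"]) (auto simp: y_word_def indices_def)
  next
    case False
    with \<open>w = [] \<or> last w = X1\<close> *[of w 0] show ?thesis by auto
  qed
qed

lemma scalar_mult_monom: "scalar c * monom w = Poly_Mapping.single w c"
  using mult_single[of "[]" c w "1"] by (simp add: plus_list_def)

lemma lookup_sum_poly_mapping:
  fixes f :: "'a \<Rightarrow> h"
  shows "Poly_Mapping.lookup (sum f A) w = (\<Sum>a\<in>A. Poly_Mapping.lookup (f a) w)"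
  by (induction A rule: infinite_finite_induct) (simp_all add: lookup_add)

lemma poly_mapping_expansion:
  fixes p :: h
  shows "p = (\<Sum>w\<in>Poly_Mapping.keys p. scalar (Poly_Mapping.lookup p w) * monom w)"
  by (rule poly_mapping_eqI)
     (auto simp: lookup_sum_poly_mapping scalar_mult_monom lookup_single when_def in_keys_iff)

lemma scalar_commute: "scalar c * p = p * scalar c"
proof -
  have "scalar c * monom w = monom w * scalar c" for w
    using mult_single[of "[]" c w "1"] mult_single[of w 1 "[]" c] by (simp add: plus_list_def)
  then have "scalar d * monom w * scalar c = scalar d * (scalar c * monom w)" for d w
    by (simp only: mult.assoc)
  then have "scalar c * (scalar d * monom w) = scalar d * monom w * scalar c" for d w
    by (simp only: mult.assoc[symmetric] scalar_mult mult.commute[of c d])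
  then have "scalar c * (\<Sum>w\<in>Poly_Mapping.keys p. scalar (Poly_Mapping.lookup p w) * monom w)
     = (\<Sum>w\<in>Poly_Mapping.keys p. scalar (Poly_Mapping.lookup p w) * monom w) * scalar c"
    by (simp add: sum_distrib_left sum_distrib_right)
  then show ?thesis unfolding poly_mapping_expansion[of p, symmetric] .
qed

lemma linear_ext_fun_add: "linear_ext (\<lambda>w. f w + g w) p = linear_ext f p + linear_ext g p"
  by (simp add: linear_ext_def distrib_left sum.distrib)

lemma linear_ext_fun_mult: "linear_ext (\<lambda>w. q * f w) p = q * linear_ext f p"
proof -
  have "scalar c * (q * f w) = q * (scalar c * f w)" for c w
    by (metis mult.assoc scalar_commute)
  then show ?thesis by (simp add: linear_ext_def sum_distrib_left)
qed

lemma linear_ext_sum: "linear_ext f (sum g A) = (\<Sum>a\<in>A. linear_ext f (g a))"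
proof (induction A rule: infinite_finite_induct)
qed (simp_all add: linear_ext_add, simp_all add: linear_ext_def)

lemma linear_ext_shift: "linear_ext f (monom u * p) = linear_ext (\<lambda>w. f (u @ w)) p"
proof -
  have "monom u * (scalar c * monom w) = scalar c * monom (u @ w)" for c w
    by (metis monom_append mult.assoc scalar_commute)
  then have "monom u * p =
      (\<Sum>w\<in>Poly_Mapping.keys p. scalar (Poly_Mapping.lookup p w) * monom (u @ w))"
    by (subst poly_mapping_expansion[of p]) (simp add: sum_distrib_left)
  then show ?thesis
    by (simp add: linear_ext_sum linear_ext_scale) (simp add: linear_ext_def)
qed

lemma shuffle_add_left: "(p + p') \<squnion>\<squnion> q = p \<squnion>\<squnion> q + p' \<squnion>\<squnion> q"
  by (simp add: shuffle_def linear_ext_add)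

lemma shuffle_add_right: "p \<squnion>\<squnion> (q + q') = p \<squnion>\<squnion> q + p \<squnion>\<squnion> q'"
  by (simp add: shuffle_def linear_ext_add linear_ext_fun_add)

lemma shuffle_scale_left: "(scalar c * p) \<squnion>\<squnion> q = scalar c * (p \<squnion>\<squnion> q)"
  by (simp add: shuffle_def linear_ext_scale)

lemma shuffle_scale_right: "p \<squnion>\<squnion> (scalar c * q) = scalar c * (p \<squnion>\<squnion> q)"
  by (simp add: shuffle_def linear_ext_scale linear_ext_fun_mult)

lemma linear_ext_id: "linear_ext (\<lambda>w. monom w) p = p"
  unfolding linear_ext_def by (rule poly_mapping_expansion[symmetric])

lemma shuffle_word_Nil_right: "shuffle_word w [] = monom w"
  by (cases w) auto

lemma shuffle_1_left: "1 \<squnion>\<squnion> p = p"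
proof -
  have "shuffle_word [] = (\<lambda>w. monom w)" by auto
  then show ?thesis by (simp add: shuffle_def linear_ext_id flip: scalar_one)
qed

lemma shuffle_1_right: "p \<squnion>\<squnion> 1 = p"
  by (simp add: shuffle_def shuffle_word_Nil_right linear_ext_id flip: scalar_one)

lemma phi_1: "\<phi> 1 = 1"
  using phi_y[of "[]"] by (simp add: shuffle_1_left)

lemma shuffle_rec:
  assumes "u \<in> {x\<^sub>0, x\<^sub>1}" "v \<in> {x\<^sub>0, x\<^sub>1}"
  shows "(u * p) \<squnion>\<squnion> (v * q) = u * (p \<squnion>\<squnion> (v * q)) + v * ((u * p) \<squnion>\<squnion> q)"
proof -
  from assms obtain a b where "u = monom [a]" "v = monom [b]"
    by (auto simp: x\<^sub>0_def x\<^sub>1_def)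
  then show ?thesis
    by (simp add: shuffle_def linear_ext_shift linear_ext_fun_add linear_ext_fun_mult)
qed

lemma h\<^sub>1_eq: "h\<^sub>1 = {p. Poly_Mapping.keys p \<subseteq> y_word ` indices}"
proof (intro set_eqI iffI)
  fix p assume "p \<in> h\<^sub>1"
  then obtain c q where p: "p = scalar c + q * x\<^sub>1" by (auto simp: h\<^sub>1_def)
  have "Poly_Mapping.keys p \<subseteq> Poly_Mapping.keys (scalar c) \<union> Poly_Mapping.keys (q * x\<^sub>1)"
    unfolding p by (rule Poly_Mapping.keys_add)
  moreover have "Poly_Mapping.keys (q * x\<^sub>1) \<subseteq> {w @ [X1] | w. True}"
    using keys_mult[of q x\<^sub>1] by (auto simp: x\<^sub>1_def plus_list_def)
  moreover have "Poly_Mapping.keys (scalar c) \<subseteq> {[]}" by simp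
  ultimately have "Poly_Mapping.keys p \<subseteq> {[]} \<union> {w @ [X1] | w. True}" by blast
  then show "p \<in> {p. Poly_Mapping.keys p \<subseteq> y_word ` indices}"
    by (fastforce simp: mem_y_words_iff)
next
  have add: "p + q \<in> h\<^sub>1" if "p \<in> h\<^sub>1" "q \<in> h\<^sub>1" for p q
  proof -
    from that obtain c d p' q' where
      "p = scalar c + p' * x\<^sub>1" "q = scalar d + q' * x\<^sub>1" by (auto simp: h\<^sub>1_def)
    then have "p + q = scalar (c + d) + (p' + q') * x\<^sub>1"
      by (simp add: single_add algebra_simps)
    then show ?thesis unfolding h\<^sub>1_def by blast
  qed
  have zero: "0 \<in> h\<^sub>1" unfolding h\<^sub>1_def by (auto intro!: exI[of _ 0])
  have mono: "scalar c * monom w \<in> h\<^sub>1" if "w \<in> y_word ` indices" for c w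
  proof (cases "w = []")
    case True
    then have "scalar c * monom w = scalar c + 0 * x\<^sub>1" by (simp add: scalar_one)
    then show ?thesis unfolding h\<^sub>1_def by blast
  next
    case False
    with that obtain v where "w = v @ [X1]"
      by (metis mem_y_words_iff append_butlast_last_id)
    then have "scalar c * monom w = scalar 0 + (scalar c * monom v) * x\<^sub>1"
      by (simp add: monom_append x\<^sub>1_def mult.assoc)
    then show ?thesis unfolding h\<^sub>1_def by blast
  qed
  fix p :: h assume p: "p \<in> {p. Poly_Mapping.keys p \<subseteq> y_word ` indices}"
  have "(\<Sum>w\<in>A. scalar (Poly_Mapping.lookup p w) * monom w) \<in> h\<^sub>1"
    if "finite A" "A \<subseteq> y_word ` indices" for A
    using that by (induction A rule: finite_induct) (auto intro: zero add mono)
  from this[of "Poly_Mapping.keys p"] p show "p \<in> h\<^sub>1"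
    unfolding poly_mapping_expansion[of p, symmetric] by simp
qed

lemma keys_shuffle_word:
  assumes "u \<in> y_word ` indices" "v \<in> y_word ` indices"
  shows "Poly_Mapping.keys (shuffle_word u v) \<subseteq> y_word ` indices"
proof -
  have *: "w \<noteq> [] \<and> last w = X1"
    if "u \<noteq> [] \<or> v \<noteq> []" "u = [] \<or> last u = X1" "v = [] \<or> last v = X1"
      "w \<in> Poly_Mapping.keys (shuffle_word u v)" for u v w
    using that
  proof (induction u v arbitrary: w rule: shuffle_word.induct)
    case (3 a u b v)
    from "3.prems"(4) Poly_Mapping.keys_add
    consider "w \<in> Poly_Mapping.keys (monom [a] * shuffle_word u (b # v))"
      | "w \<in> Poly_Mapping.keys (monom [b] * shuffle_word (a # u) v)"
      by fastforce
    then show ?case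
    proof cases
      case 1
      with keys_mult obtain w' where
        "w = a # w'" "w' \<in> Poly_Mapping.keys (shuffle_word u (b # v))"
        by (fastforce simp: plus_list_def)
      with "3.IH"(1)[of w'] "3.prems" show ?thesis by (auto split: if_splits)
    next
      case 2
      with keys_mult obtain w' where
        "w = b # w'" "w' \<in> Poly_Mapping.keys (shuffle_word (a # u) v)"
        by (fastforce simp: plus_list_def)
      with "3.IH"(2)[of w'] "3.prems" show ?thesis by (auto split: if_splits)
    qed
  qed auto
  show ?thesis
  proof (cases "u = [] \<and> v = []")
    case True
    then show ?thesis by (simp add: mem_y_words_iff)
  next
    case False
    then show ?thesis using * assms unfolding mem_y_words_iff subset_iff by blast
  qed
qed

lemma h\<^sub>1_add: "p \<in> h\<^sub>1 \<Longrightarrow> q \<in> h\<^sub>1 \<Longrightarrow> p + q \<in> h\<^sub>1"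
  using Poly_Mapping.keys_add[of p q] by (auto simp: h\<^sub>1_eq)

lemma h\<^sub>1_scale: "p \<in> h\<^sub>1 \<Longrightarrow> scalar c * p \<in> h\<^sub>1"
  by (auto simp: h\<^sub>1_eq in_keys_iff lookup_scalar_mult subset_iff)

lemma h\<^sub>1_zero: "0 \<in> h\<^sub>1"
  by (simp add: h\<^sub>1_eq)

lemma h\<^sub>1_sum: "(\<And>a. a \<in> A \<Longrightarrow> f a \<in> h\<^sub>1) \<Longrightarrow> sum f A \<in> h\<^sub>1"
  by (induction A rule: infinite_finite_induct) (auto intro: h\<^sub>1_add h\<^sub>1_zero)

lemma h\<^sub>1_linear_ext:
  "(\<And>w. w \<in> Poly_Mapping.keys p \<Longrightarrow> f w \<in> h\<^sub>1) \<Longrightarrow> linear_ext f p \<in> h\<^sub>1"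
  unfolding linear_ext_def by (intro h\<^sub>1_sum h\<^sub>1_scale)

lemma h\<^sub>1_shuffle: "p \<in> h\<^sub>1 \<Longrightarrow> q \<in> h\<^sub>1 \<Longrightarrow> p \<squnion>\<squnion> q \<in> h\<^sub>1"
  unfolding shuffle_def
  by (intro h\<^sub>1_linear_ext) (unfold h\<^sub>1_eq mem_Collect_eq, rule keys_shuffle_word, auto)

lemma neg_one_power: "(-1 :: h) ^ n = scalar ((-1) ^ n)"
  by (induction n) (simp_all add: scalar_one single_uminus)

lemma prod_list_y_in_h\<^sub>1: "ks \<in> indices \<Longrightarrow> prod_list (map y ks) \<in> h\<^sub>1"
  by (simp add: prod_list_y h\<^sub>1_eq)

lemma phi_in_h\<^sub>1: "\<phi> p \<in> h\<^sub>1"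
proof -
  have "phi_index ks \<in> h\<^sub>1" if "ks \<in> indices" for ks
    unfolding phi_index_def neg_one_power using that
    by (intro h\<^sub>1_sum h\<^sub>1_scale h\<^sub>1_shuffle prod_list_y_in_h\<^sub>1)
       (auto simp: indices_def dest: in_set_takeD in_set_dropD)
  then show ?thesis
    unfolding \<phi>_def by (intro h\<^sub>1_linear_ext) (simp add: inv_into_into h\<^sub>1_zero)
qed

end

theory Submission
  imports Defs
begin

text \<open>
  Let \<open>R(g, w) = \<Sum> (-1)^(|u| + 1) (rev(u) g) \<squnion>\<squnion> v\<close>, summed over all factorisations \<open>w = u x\<^sub>1 v\<close>.
  On words in \<open>h\<^sub>1\<close> one has \<open>\<phi>(w) = w + R(x\<^sub>1, w)\<close>. The key point is that for every letter \<open>c\<close>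
  the map \<open>R\<close> behaves like a derivation of the shuffle product,
  \<open>R(c z, p \<squnion>\<squnion> q) = R(c (z \<squnion>\<squnion> q), p) + R(c (z \<squnion>\<squnion> p), q)\<close>.
  Moreover \<open>R(x\<^sub>1, x\<^sub>0^k p) = (-1)^k R(x\<^sub>0 y_k, p)\<close> and \<open>R(x\<^sub>0 z, y_k) = (-1)^k x\<^sub>0^k z\<close>, so expanding
  \<open>R\<close> on a shuffle product of generators \<open>y_k\<close> yields the sum on the right-hand side.
\<close>

section \<open>The shuffle algebra\<close>

text \<open>Words span the algebra, and 0 arises as 0 times a word. This reduces identities that are
  linear in an argument to words.\<close>

lemma h_induct [case_names monom add scale]:
  assumes "\<And>w. P (monom w)"
    and "\<And>p q. P p \<Longrightarrow> P q \<Longrightarrow> P (p + q)"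
    and "\<And>c p. P p \<Longrightarrow> P (scalar c * p)"
  shows "P p"
proof -
  have zero: "P 0"
    using assms(3)[OF assms(1), of 0 "[]"] by simp
  have "P (\<Sum>w\<in>A. scalar (Poly_Mapping.lookup p w) * monom w)" for A
    by (induction A rule: infinite_finite_induct) (auto intro: assms zero)
  then show ?thesis
    by (subst poly_mapping_expansion)
qed

lemma scalar_left_commute: "p * (scalar c * q) = scalar c * (p * q)"
  by (metis mult.assoc scalar_commute)

lemma shuffle_monom: "monom u \<squnion>\<squnion> monom v = shuffle_word u v"
  by (simp add: shuffle_def)

lemma shuffle_letter_rec:
  "(monom [a] * p) \<squnion>\<squnion> (monom [b] * q) =
     monom [a] * (p \<squnion>\<squnion> (monom [b] * q)) + monom [b] * ((monom [a] * p) \<squnion>\<squnion> q)"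
  by (simp add: shuffle_def linear_ext_shift linear_ext_fun_add linear_ext_fun_mult)

lemma monom_Cons: "monom (a # w) = monom [a] * monom w"
  using monom_append[of "[a]" w] by simp

lemma shuffle_commute: "p \<squnion>\<squnion> q = q \<squnion>\<squnion> p"
proof -
  have words: "shuffle_word u v = shuffle_word v u" for u v
    by (induction u v rule: shuffle_word.induct) (auto simp: shuffle_word_Nil_right)
  have "monom u \<squnion>\<squnion> q = q \<squnion>\<squnion> monom u" for u
    by (induction q rule: h_induct)
       (auto simp: shuffle_monom words shuffle_add_left shuffle_add_right
          shuffle_scale_left shuffle_scale_right)
  then show ?thesis
    by (induction p rule: h_induct)
       (auto simp: shuffle_add_left shuffle_add_right shuffle_scale_left shuffle_scale_right)
qed

lemma shuffle_assoc: "(p \<squnion>\<squnion> q) \<squnion>\<squnion> s = p \<squnion>\<squnion> (q \<squnion>\<squnion> s)"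
proof -
  have words: "(monom u \<squnion>\<squnion> monom v) \<squnion>\<squnion> monom w = monom u \<squnion>\<squnion> (monom v \<squnion>\<squnion> monom w)" for u v w
  proof (induction "length u + length v + length w" arbitrary: u v w rule: less_induct)
    case less
    show ?case
    proof (cases "u = [] \<or> v = [] \<or> w = []")
      case True
      then show ?thesis
        by (auto simp: scalar_one shuffle_1_left shuffle_1_right)
    next
      case False
      then obtain a u' b v' c w' where uvw: "u = a # u'" "v = b # v'" "w = c # w'"
        by (meson neq_Nil_conv)
      let ?a = "monom [a]" and ?b = "monom [b]" and ?c = "monom [c]"
      let ?u = "monom u'" and ?v = "monom v'" and ?w = "monom w'"
      \<comment> \<open>Expanding both sides by the recursion leaves terms led by \<open>a\<close>,
        \<open>b\<close> or \<open>c\<close>. Collected by leading letter, they differ only inside,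
        by associativity for a triple with that letter removed.\<close>
      have IH: "(?u \<squnion>\<squnion> (?b * ?v)) \<squnion>\<squnion> (?c * ?w) = ?u \<squnion>\<squnion> ((?b * ?v) \<squnion>\<squnion> (?c * ?w))"
        "((?a * ?u) \<squnion>\<squnion> ?v) \<squnion>\<squnion> (?c * ?w) = (?a * ?u) \<squnion>\<squnion> (?v \<squnion>\<squnion> (?c * ?w))"
        "((?a * ?u) \<squnion>\<squnion> (?b * ?v)) \<squnion>\<squnion> ?w = (?a * ?u) \<squnion>\<squnion> ((?b * ?v) \<squnion>\<squnion> ?w)"
        using less[of u' "b # v'" "c # w'"] less[of "a # u'" v' "c # w'"]
          less[of "a # u'" "b # v'" w']
        by (simp_all add: uvw monom_Cons[of a u'] monom_Cons[of b v'] monom_Cons[of c w'])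
      show ?thesis
        unfolding uvw monom_Cons[of a u'] monom_Cons[of b v'] monom_Cons[of c w']
        using IH
        by (simp add: shuffle_letter_rec shuffle_add_left shuffle_add_right distrib_left) (simp flip: distrib_left)
    qed
  qed
  have "(monom u \<squnion>\<squnion> monom v) \<squnion>\<squnion> s = monom u \<squnion>\<squnion> (monom v \<squnion>\<squnion> s)" for u v
    by (induction s rule: h_induct)
       (auto simp: words shuffle_add_right shuffle_scale_right)
  then have "(monom u \<squnion>\<squnion> q) \<squnion>\<squnion> s = monom u \<squnion>\<squnion> (q \<squnion>\<squnion> s)" for u
    by (induction q rule: h_induct)
       (auto simp: shuffle_add_left shuffle_add_right shuffle_scale_left shuffle_scale_right)
  then show ?thesis
    by (induction p rule: h_induct) (auto simp: shuffle_add_left shuffle_scale_left)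
qed

lemma shuffle_list_Cons: "shuffle_list (p # ps) = p \<squnion>\<squnion> shuffle_list ps"
  by (simp add: shuffle_list_def)

text \<open>Lets \<open>y (k r)\<close> be appended as the last factor, where the right-hand side of
  the theorem has it.\<close>

lemma shuffle_list_snoc: "shuffle_list (ps @ [p]) = p \<squnion>\<squnion> shuffle_list ps"
proof (induction ps)
  case (Cons q ps)
  then show ?case
    by (metis append_Cons shuffle_assoc shuffle_commute shuffle_list_Cons)
qed (simp add: shuffle_list_def)

section \<open>Reflected sums\<close>

text \<open>This is R(g, w), with \<open>g\<close> as accumulator: a letter passed over moves to the
  front of \<open>g\<close>, which builds up the reversed prefix. Each letter passed over costs a
  sign, and so does the deleted cut letter \<open>X1\<close>.\<close>

fun refl_word :: "h \<Rightarrow> word \<Rightarrow> h" where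
  "refl_word g [] = 0"
| "refl_word g (a # w) =
     - (if a = X1 then g \<squnion>\<squnion> monom w else 0) - refl_word (monom [a] * g) w"

definition refl_sum :: "h \<Rightarrow> h \<Rightarrow> h" where
  "refl_sum g p = linear_ext (refl_word g) p"

lemma refl_sum_monom [simp]: "refl_sum g (monom w) = refl_word g w"
  by (simp add: refl_sum_def)

lemma refl_sum_add_right: "refl_sum g (p + q) = refl_sum g p + refl_sum g q"
  by (simp add: refl_sum_def linear_ext_add)

lemma refl_sum_scale_right: "refl_sum g (scalar c * p) = scalar c * refl_sum g p"
  by (simp add: refl_sum_def linear_ext_scale)

lemma refl_word_add: "refl_word (g + g') w = refl_word g w + refl_word g' w"
  by (induction w arbitrary: g g') (auto simp: shuffle_add_left distrib_left)

lemma refl_word_scale: "refl_word (scalar c * g) w = scalar c * refl_word g w"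
  by (induction w arbitrary: g)
     (auto simp: shuffle_scale_left right_diff_distrib scalar_left_commute)

lemma refl_sum_add_left: "refl_sum (g + g') p = refl_sum g p + refl_sum g' p"
  by (induction p rule: h_induct)
     (auto simp: refl_word_add refl_sum_add_right refl_sum_scale_right distrib_left)

lemma refl_sum_scale_left: "refl_sum (scalar c * g) p = scalar c * refl_sum g p"
proof (induction p rule: h_induct)
  case (scale d p)
  then show ?case
    by (simp only: refl_sum_scale_right scalar_left_commute[of "scalar c" d])
qed (simp_all add: refl_word_scale refl_sum_add_right distrib_left)

lemma refl_sum_diff_left: "refl_sum (g - g') p = refl_sum g p - refl_sum g' p"
  using refl_sum_add_left[of "g - g'" g' p] by simp

lemma refl_sum_letter:
  "refl_sum g (monom [a] * p) =
     - (if a = X1 then g \<squnion>\<squnion> p else 0) - refl_sum (monom [a] * g) p"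
proof (induction p rule: h_induct)
  case (monom w)
  then show ?case
    by (simp flip: monom_Cons)
next
  case (add p q)
  then show ?case
    by (simp add: distrib_left refl_sum_add_right shuffle_add_right)
next
  case (scale c p)
  then show ?case
    by (simp add: scalar_left_commute refl_sum_scale_right shuffle_scale_right
        right_diff_distrib)
qed

text \<open>No cut occurs at a letter \<open>X0\<close>, so each one merely moves to the front of
  \<open>g\<close> and changes the sign.\<close>

lemma refl_sum_x0_power: "refl_sum g (x\<^sub>0 ^ n * p) = (-1) ^ n * refl_sum (x\<^sub>0 ^ n * g) p"
proof (induction n arbitrary: g)
  case (Suc n)
  have "refl_sum g (x\<^sub>0 ^ Suc n * p) = - refl_sum (x\<^sub>0 * g) (x\<^sub>0 ^ n * p)"
    by (simp add: x\<^sub>0_def mult.assoc refl_sum_letter)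
  also have "\<dots> = (-1) ^ Suc n * refl_sum (x\<^sub>0 ^ Suc n * g) p"
    unfolding Suc by (simp add: mult.assoc power_Suc2 del: power_Suc)
  finally show ?case .
qed simp

text \<open>Induction on two words: both sides expand into the same cut terms and the same reflected
  sums of smaller shuffles.\<close>

lemma refl_sum_shuffle:
  "refl_sum (monom [c] * z) (p \<squnion>\<squnion> q) =
     refl_sum (monom [c] * (z \<squnion>\<squnion> q)) p + refl_sum (monom [c] * (z \<squnion>\<squnion> p)) q"
proof -
  have words: "refl_sum (monom [c] * z) (monom u \<squnion>\<squnion> monom v) =
      refl_sum (monom [c] * (z \<squnion>\<squnion> monom v)) (monom u) +
      refl_sum (monom [c] * (z \<squnion>\<squnion> monom u)) (monom v)" for u v
  proof (induction u v arbitrary: c z rule: shuffle_word.induct)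
    case (3 a u b v)
    define U where "U = monom (a # u)"
    define V where "V = monom (b # v)"
    define g where "g = monom [c] * z"
    have UV: "U = monom [a] * monom u" "V = monom [b] * monom v"
      by (simp_all add: U_def V_def monom_Cons[of a u] monom_Cons[of b v])
    have prod: "U \<squnion>\<squnion> V = monom [a] * (monom u \<squnion>\<squnion> V) + monom [b] * (U \<squnion>\<squnion> monom v)"
      unfolding UV by (rule shuffle_letter_rec)
    \<comment> \<open>The shuffle recursion is solved for the term led by \<open>c\<close>; this is
      where the leading letter of the first argument of R is used.\<close>
    have gV: "monom [c] * (z \<squnion>\<squnion> V) = g \<squnion>\<squnion> V - monom [b] * (g \<squnion>\<squnion> monom v)"
      unfolding UV g_def by (simp add: shuffle_letter_rec)
    have gU: "monom [c] * (z \<squnion>\<squnion> U) = g \<squnion>\<squnion> U - monom [a] * (g \<squnion>\<squnion> monom u)"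
      unfolding UV g_def by (simp add: shuffle_letter_rec)
    \<comment> \<open>The induction hypothesis is taken with \<open>a\<close> for \<open>c\<close>
      and \<open>g\<close> for \<open>z\<close>, which is why both are generalised.\<close>
    have IHu: "refl_sum (monom [a] * g) (monom u \<squnion>\<squnion> V) =
        refl_sum (monom [a] * (g \<squnion>\<squnion> V)) (monom u) + refl_sum (monom [a] * (g \<squnion>\<squnion> monom u)) V"
      unfolding V_def by (rule "3.IH"(1))
    have IHv: "refl_sum (monom [b] * g) (U \<squnion>\<squnion> monom v) =
        refl_sum (monom [b] * (g \<squnion>\<squnion> monom v)) U + refl_sum (monom [b] * (g \<squnion>\<squnion> U)) (monom v)"
      unfolding U_def by (rule "3.IH"(2))
    have RU: "refl_sum (g \<squnion>\<squnion> V) U =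
        - (if a = X1 then g \<squnion>\<squnion> (monom u \<squnion>\<squnion> V) else 0) - refl_sum (monom [a] * (g \<squnion>\<squnion> V)) (monom u)"
      unfolding UV(1) refl_sum_letter by (simp add: shuffle_assoc shuffle_commute[of V])
    have RV: "refl_sum (g \<squnion>\<squnion> U) V =
        - (if b = X1 then g \<squnion>\<squnion> (U \<squnion>\<squnion> monom v) else 0) - refl_sum (monom [b] * (g \<squnion>\<squnion> U)) (monom v)"
      unfolding UV(2) refl_sum_letter by (simp add: shuffle_assoc)
    have "refl_sum g (U \<squnion>\<squnion> V) =
        refl_sum (monom [c] * (z \<squnion>\<squnion> V)) U + refl_sum (monom [c] * (z \<squnion>\<squnion> U)) V"
      unfolding prod gU gV refl_sum_add_right refl_sum_letter IHu IHv refl_sum_diff_left RU RV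
      by (simp add: algebra_simps)
    then show ?case
      unfolding U_def V_def g_def .
  qed (simp_all add: scalar_one shuffle_1_left shuffle_1_right
        refl_sum_monom[of _ "[]", unfolded scalar_one] del: refl_sum_monom)
  have "refl_sum (monom [c] * z) (monom u \<squnion>\<squnion> q) =
      refl_sum (monom [c] * (z \<squnion>\<squnion> q)) (monom u) + refl_sum (monom [c] * (z \<squnion>\<squnion> monom u)) q" for u
    by (induction q rule: h_induct)
       (auto simp: words refl_sum_add_right refl_sum_scale_right refl_sum_add_left
          refl_sum_scale_left shuffle_add_right shuffle_scale_right distrib_left
          scalar_left_commute simp del: refl_sum_monom)
  then show ?thesis
    by (induction p rule: h_induct)
       (auto simp: refl_sum_add_right refl_sum_scale_right refl_sum_add_left
          refl_sum_scale_left shuffle_add_left shuffle_scale_left shuffle_add_right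
          shuffle_scale_right distrib_left scalar_left_commute simp del: refl_sum_monom)
qed

text \<open>The derivation rule splits off one factor at a time; factors already passed are absorbed
  into \<open>z\<close>.\<close>

lemma refl_sum_shuffle_list:
  "refl_sum (monom [c] * z) (shuffle_list ps) =
     (\<Sum>a<length ps. refl_sum (monom [c] * (z \<squnion>\<squnion> shuffle_list (take a ps @ drop (Suc a) ps))) (ps ! a))"
proof (induction ps arbitrary: z)
  case Nil
  then show ?case
    by (simp add: shuffle_list_def flip: scalar_one)
next
  case (Cons p ps)
  show ?case
    unfolding shuffle_list_Cons refl_sum_shuffle Cons
    by (simp add: sum.lessThan_Suc_shift shuffle_list_Cons shuffle_assoc del: sum.lessThan_Suc)
qed

text \<open>The only cut is at the final letter. The \<open>k - 1\<close> letters before it join the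
  leading \<open>x\<^sub>0\<close>, and together with the cut they give \<open>k\<close>
  signs.\<close>

lemma refl_sum_y:
  assumes "1 \<le> k"
  shows "refl_sum (x\<^sub>0 * z) (y k) = (-1) ^ k * x\<^sub>0 ^ k * z"
proof -
  obtain n where k: "k = Suc n"
    using assms by (cases k) auto
  have "refl_sum g x\<^sub>1 = - g" for g
    by (simp add: x\<^sub>1_def scalar_one shuffle_1_right)
  then show ?thesis
    unfolding y_def refl_sum_x0_power by (simp add: k mult.assoc power_Suc2 del: power_Suc)
qed

section \<open>The map \<open>\<phi>\<close>\<close>

text \<open>Cuts occur exactly at the ends of the blocks \<open>y k\<close>. Reversal puts the
  \<open>X1\<close> of each block on its wrong side and the cut deletes the last one, but the
  \<open>x\<^sub>1\<close> in front of \<open>g\<close> shifts the block boundaries so that the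
  blocks reappear in reverse order.\<close>

lemma refl_sum_prod_list_y:
  assumes "\<forall>k\<in>set ks. 1 \<le> k"
  shows "refl_sum (x\<^sub>1 * g) (prod_list (map y ks)) =
    (\<Sum>a=1..length ks. (-1) ^ sum_list (take a ks) *
       ((prod_list (map y (rev (take a ks))) * g) \<squnion>\<squnion> prod_list (map y (drop a ks))))"
  using assms
proof (induction ks arbitrary: g)
  case Nil
  then show ?case
    by (simp flip: scalar_one)
next
  case (Cons k ks)
  let ?P = "prod_list (map y ks)"
  obtain n where k: "k = Suc n"
    using Cons.prems by (cases k) auto
  have "refl_sum (x\<^sub>1 * g) (y k * ?P) = (-1) ^ n * refl_sum (y k * g) (x\<^sub>1 * ?P)"
    by (simp add: y_def k mult.assoc refl_sum_x0_power)
  \<comment> \<open>Cutting at this \<open>x\<^sub>1\<close> gives the summand a = 1; passing over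
    it gives the later ones with \<open>y k * g\<close> as the new \<open>g\<close>. Either way one
    more sign turns \<open>n\<close> into \<open>k\<close>.\<close>
  also have "\<dots> = (-1) ^ k * ((y k * g) \<squnion>\<squnion> ?P + refl_sum (x\<^sub>1 * (y k * g)) ?P)"
    by (simp add: k x\<^sub>1_def refl_sum_letter algebra_simps)
  finally show ?case
    using Cons
    by (simp add: sum.atLeast_Suc_atMost sum.atLeast_Suc_atMost_Suc_shift distrib_left
        sum_distrib_left power_add mult.assoc del: sum.cl_ivl_Suc)
qed

text \<open>The summand a = 0 of \<open>\<phi>\<close> is the word itself, and the others form the
  reflected sum with g = 1. Membership in \<open>h\<^sub>1\<close> matters since
  \<open>\<phi>\<close> is set to 0 on all other words.\<close>

lemma phi_eq_refl_sum:
  assumes "p \<in> h\<^sub>1"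
  shows "\<phi> p = p + refl_sum x\<^sub>1 p"
proof -
  have words: "\<phi> (monom w) = monom w + refl_sum x\<^sub>1 (monom w)" if "w \<in> y_word ` indices" for w
  proof -
    from that obtain ks where ks: "w = y_word ks" "\<forall>k\<in>set ks. 1 \<le> k"
      by (auto simp: indices_def)
    show ?thesis
      using phi_y[OF ks(2)] refl_sum_prod_list_y[OF ks(2), of 1]
      by (simp add: ks(1) sum.atLeast_Suc_atMost shuffle_1_left flip: prod_list_y
          del: refl_sum_monom)
  qed
  \<comment> \<open>Linearity is applied to sums over admissible words only, as
    \<open>h_induct\<close> would also demand the words outside \<open>h\<^sub>1\<close>.\<close>
  have "\<phi> (\<Sum>w\<in>A. scalar (Poly_Mapping.lookup p w) * monom w) =
      (\<Sum>w\<in>A. scalar (Poly_Mapping.lookup p w) * monom w) +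
      refl_sum x\<^sub>1 (\<Sum>w\<in>A. scalar (Poly_Mapping.lookup p w) * monom w)"
    if "finite A" "A \<subseteq> y_word ` indices" for A
    using that
    by (induction A rule: finite_induct)
       (auto simp: words phi_add phi_scale refl_sum_add_right refl_sum_scale_right distrib_left
          simp del: refl_sum_monom, simp_all add: \<phi>_def refl_sum_def linear_ext_def)
  from this[of "Poly_Mapping.keys p"] assms show ?thesis
    unfolding poly_mapping_expansion[of p, symmetric] by (simp add: h\<^sub>1_eq)
qed

section \<open>Constant terms and membership in \<open>h\<^sub>1\<close>\<close>

lemma lookup_letter_mult_Nil: "Poly_Mapping.lookup (monom [a] * p) [] = 0"
proof -
  have "[] \<notin> Poly_Mapping.keys (monom [a] * p)"
    using keys_mult[of "monom [a]" p] by (auto simp: plus_list_def)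
  then show ?thesis
    by (simp add: in_keys_iff)
qed

text \<open>A shuffle of two words contains the empty word only if both are empty. Hence one factor
  \<open>y k\<close> already kills the constant term of a shuffle product.\<close>

lemma lookup_shuffle_Nil:
  "Poly_Mapping.lookup (p \<squnion>\<squnion> q) [] = Poly_Mapping.lookup p [] * Poly_Mapping.lookup q []"
proof -
  have words: "Poly_Mapping.lookup (shuffle_word u v) [] =
      Poly_Mapping.lookup (monom u) [] * Poly_Mapping.lookup (monom v) []" for u v
    by (cases "(u, v)" rule: shuffle_word.cases)
       (auto simp: lookup_add lookup_letter_mult_Nil lookup_single)
  have "Poly_Mapping.lookup (monom u \<squnion>\<squnion> q) [] =
      Poly_Mapping.lookup (monom u) [] * Poly_Mapping.lookup q []" for u
    by (induction q rule: h_induct)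
       (auto simp: shuffle_monom words shuffle_add_right shuffle_scale_right lookup_add
          lookup_scalar_mult algebra_simps)
  then show ?thesis
    by (induction p rule: h_induct)
       (auto simp: shuffle_add_left shuffle_scale_left lookup_add lookup_scalar_mult
          algebra_simps)
qed

text \<open>A nonempty word keeps its last letter \<open>X1\<close> under prefixing. A constant term
  would instead produce a power of \<open>x\<^sub>0\<close>, which for \<open>n\<close> > 0 lies
  outside \<open>h\<^sub>1\<close>.\<close>

lemma h\<^sub>1_x0_power_mult:
  assumes "p \<in> h\<^sub>1" "Poly_Mapping.lookup p [] = 0"
  shows "x\<^sub>0 ^ n * p \<in> h\<^sub>1"
proof -
  have "w \<noteq> [] \<and> last w = X1" if "w \<in> Poly_Mapping.keys p" for w
    using that assms by (auto simp: h\<^sub>1_eq in_keys_iff subset_iff mem_y_words_iff)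
  moreover have "Poly_Mapping.keys (x\<^sub>0 ^ n * p) \<subseteq> (\<lambda>w. replicate n X0 @ w) ` Poly_Mapping.keys p"
    using keys_mult[of "x\<^sub>0 ^ n" p] by (auto simp: x0_power plus_list_def)
  ultimately show ?thesis
    by (fastforce simp: h\<^sub>1_eq mem_y_words_iff)
qed

lemma y_eq_prod_list: "y k = prod_list (map y [k])"
  by simp

lemma lookup_y_Nil: "Poly_Mapping.lookup (y k) [] = 0"
  unfolding y_eq_prod_list prod_list_y by (simp add: y_word_def lookup_single)

lemma shuffle_list_y_in_h\<^sub>1:
  assumes "\<forall>k\<in>set ks. 1 \<le> k"
  shows "shuffle_list (map y ks) \<in> h\<^sub>1"
  using assms
proof (induction ks)
  case Nil
  then show ?case
    using prod_list_y_in_h\<^sub>1[of "[]"] by (simp add: shuffle_list_def indices_def)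
next
  case (Cons k ks)
  then show ?case
    using prod_list_y_in_h\<^sub>1[of "[k]"]
    by (simp add: shuffle_list_Cons indices_def h\<^sub>1_shuffle)
qed

theorem theorem4p6:
  fixes k :: "nat \<Rightarrow> nat" and r :: nat
  assumes "r \<ge> 2" and "\<forall>i\<in>{1..r}. k i \<ge> 1"
  shows "\<phi> ((-1) ^ k r * x\<^sub>0 ^ k r * shuffle_list (map (\<lambda>i. y (k i)) [1..<r])) =
    (\<Sum>a=1..r. (-1) ^ k a * x\<^sub>0 ^ k a *
       shuffle_list (map (\<lambda>i. y (k i)) ([1..<a] @ [a+1..<r+1])))"
proof -
  obtain m where r: "r = Suc m" and m: "1 \<le> m"
    using assms(1) by (cases r) auto
  define ps where "ps = map (\<lambda>i. y (k i)) [1..<r]"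
  have len: "length ps = m"
    by (simp add: ps_def r)
  \<comment> \<open>Here r \<ge> 2 enters: the list is nonempty, so its shuffle product has no
    constant term.\<close>
  have ps_Cons: "ps = y (k 1) # map (\<lambda>i. y (k i)) [2..<r]"
    using m by (simp add: ps_def r upt_conv_Cons numeral_2_eq_2 del: upt_Suc)
  have ps_map: "ps = map y (map k [1..<r])"
    by (simp add: ps_def)
  have "shuffle_list ps \<in> h\<^sub>1"
    unfolding ps_map by (rule shuffle_list_y_in_h\<^sub>1) (use assms(2) in auto)
  moreover have "Poly_Mapping.lookup (shuffle_list ps) [] = 0"
    by (simp add: ps_Cons shuffle_list_Cons lookup_shuffle_Nil lookup_y_Nil)
  ultimately have mem: "x\<^sub>0 ^ k r * shuffle_list ps \<in> h\<^sub>1"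
    by (rule h\<^sub>1_x0_power_mult)
  have sign: "(-1 :: h) ^ k r * (-1) ^ k r = 1"
    unfolding neg_one_power scalar_mult by (simp add: scalar_one flip: power_mult_distrib)
  \<comment> \<open>Exposes a leading letter \<open>X0\<close>, so that the derivation rule applies
    with \<open>z = y (k r)\<close>.\<close>
  have kr: "x\<^sub>0 ^ k r * x\<^sub>1 = monom [X0] * y (k r)"
  proof -
    have "1 \<le> k r"
      using assms by auto
    then have "x\<^sub>0 ^ k r = x\<^sub>0 * x\<^sub>0 ^ (k r - 1)"
      by (cases "k r") simp_all
    then show ?thesis
      by (simp add: y_def x\<^sub>0_def mult.assoc)
  qed
  \<comment> \<open>Position \<open>a\<close> of the list \<open>ps\<close> carries the index
    \<open>Suc a\<close>. Removing that factor and adding \<open>y (k r)\<close> leaves all indices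
    except \<open>Suc a\<close>.\<close>
  have summand: "refl_sum (monom [X0] * (y (k r) \<squnion>\<squnion> shuffle_list (take a ps @ drop (Suc a) ps))) (ps ! a) =
      (-1) ^ k (Suc a) * x\<^sub>0 ^ k (Suc a) *
        shuffle_list (map (\<lambda>i. y (k i)) ([1..<Suc a] @ [Suc a+1..<r+1]))" if "a < m" for a
  proof -
    have "y (k r) \<squnion>\<squnion> shuffle_list (take a ps @ drop (Suc a) ps) =
        shuffle_list ((take a ps @ drop (Suc a) ps) @ [y (k r)])"
      by (simp only: shuffle_list_snoc)
    also have "(take a ps @ drop (Suc a) ps) @ [y (k r)] =
        map (\<lambda>i. y (k i)) ([1..<Suc a] @ [Suc a+1..<r+1])"
      using that by (simp add: ps_def r take_map drop_map)
    finally have others: "y (k r) \<squnion>\<squnion> shuffle_list (take a ps @ drop (Suc a) ps) =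
        shuffle_list (map (\<lambda>i. y (k i)) ([1..<Suc a] @ [Suc a+1..<r+1]))" .
    have "ps ! a = y (k (Suc a))" "1 \<le> k (Suc a)"
      using that assms(2) by (simp_all add: ps_def r del: upt_Suc)
    then show ?thesis
      unfolding others x\<^sub>0_def[symmetric] by (simp only: refl_sum_y)
  qed
  have "\<phi> ((-1) ^ k r * x\<^sub>0 ^ k r * shuffle_list ps) =
      (-1) ^ k r * (x\<^sub>0 ^ k r * shuffle_list ps + refl_sum x\<^sub>1 (x\<^sub>0 ^ k r * shuffle_list ps))"
    by (simp only: mult.assoc neg_one_power phi_scale phi_eq_refl_sum[OF mem])
  \<comment> \<open>Moving \<open>x\<^sub>0 ^ k r\<close> to the left argument gives a second factor
    \<open>(-1) ^ k r\<close>, cancelling the outer one. The term outside the reflected sum is the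
    summand a = r.\<close>
  also have "\<dots> = (-1) ^ k r * x\<^sub>0 ^ k r * shuffle_list ps +
      refl_sum (monom [X0] * y (k r)) (shuffle_list ps)"
    by (simp only: refl_sum_x0_power distrib_left kr mult.assoc[symmetric] sign mult_1_left)
  also have "refl_sum (monom [X0] * y (k r)) (shuffle_list ps) =
      (\<Sum>a<m. (-1) ^ k (Suc a) * x\<^sub>0 ^ k (Suc a) *
        shuffle_list (map (\<lambda>i. y (k i)) ([1..<Suc a] @ [Suc a+1..<r+1])))"
    unfolding refl_sum_shuffle_list len by (rule sum.cong) (simp_all only: lessThan_iff summand)
  also have "\<dots> = (\<Sum>a=1..m. (-1) ^ k a * x\<^sub>0 ^ k a *
        shuffle_list (map (\<lambda>i. y (k i)) ([1..<a] @ [a+1..<r+1])))"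
    by (rule sum.reindex_bij_witness[of _ "\<lambda>a. a - 1" Suc]) auto
  finally show ?thesis
    by (simp add: r ps_def add.commute del: upt_Suc)
qed

end
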